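(* For all $i\in\mathbb{N}_0$, the variational problem (T) of the tangent plane scheme (defined in the context) admits a unique solution $(v_{1,h}^i,v_{2,h}^i)\in\mathcal{K}_h[m_{1,h}^i]\times\mathcal{K}_h[m_{2,h}^i]$. In particular, each iteration of the tangent plane scheme is well defined.
   Context: $\Omega\subset\mathbb{R}^3$ is a bounded Lipschitz polyhedral domain; $\langle\cdot,\cdot\rangle$ is the $L^2(\Omega)$ inner product (also for vector- and matrix-valued functions). $a_{11},a_{22},a_{12},a_0\in\mathbb{R}$ satisfy $a_{11}+a_{22}>0$, $a_{11}a_{22}>a_{12}^2$; $\eta_\ell,\alpha_\ell>0$ ($\ell=1,2$) are constants. $\mathcal{T}_h$ is a member of a shape-regular family of tetrahedral meshes of $\Omega$ with mesh size $h$ and vertex set $\mathcal{N}_h$; $\mathcal{S}^1(\mathcal{T}_h)$ is the space of continuous piecewise affine functions, $\mathcal{I}_h$ the nodal interpolant; $\langle\psi,\phi\rangle_h=\int_\Omega\mathcal{I}_h[\psi\cdot\phi]$ for continuous $\psi,\phi$. For $m_h\in\mathcal{S}^1(\mathcal{T}_h)^3$ nonvanishing at all vertices, $\mathcal{K}_h[m_h]=\{\phi_h\in\mathcal{S}^1(\mathcal{T}_h)^3: m_h(z)\cdot\phi_h(z)=0\ \forall z\in\mathcal{N}_h\}$. Tangent plane scheme: given $h>0$, $\tau>0$ and $(m_{1,h}^0,m_{2,h}^0)\in\mathcal{S}^1(\mathcal{T}_h)^3\times\mathcal{S}^1(\mathcal{T}_h)^3$ with $|m_{\ell,h}^0(z)|=1$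 for all $z\in\mathcal{N}_h$, $\ell=1,2$, for all $i\in\mathbb{N}_0$ compute $(v_{1,h}^i,v_{2,h}^i)\in\mathcal{K}_h[m_{1,h}^i]\times\mathcal{K}_h[m_{2,h}^i]$ such that for $\ell=1,2$ and all $\phi_{\ell,h}\in\mathcal{K}_h[m_{\ell,h}^i]$ $$\text{(T)}\quad\alpha_\ell\langle v_{\ell,h}^i,\phi_{\ell,h}\rangle_h + \langle m_{\ell,h}^i\times v_{\ell,h}^i,\phi_{\ell,h}\rangle_h + \eta_\ell a_{\ell\ell}\tau\langle\nabla v_{\ell,h}^i,\nabla\phi_{\ell,h}\rangle$$ $$= -\eta_\ell a_{\ell\ell}\langle\nabla m_{\ell,h}^i,\nabla\phi_{\ell,h}\rangle - \eta_\ell a_{12}\langle\nabla m_{3-\ell,h}^i,\nabla\phi_{\ell,h}\rangle + \eta_\ell a_0\langle m_{3-\ell,h}^i,\phi_{\ell,h}\rangle,$$ and set $m_{\ell,h}^{i+1}:=m_{\ell,h}^i+\tau v_{\ell,h}^i$, $\ell=1,2$. *)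

theory Defs
  imports "HOL-Analysis.Analysis"
begin

section \<open>Domains and meshes\<close>

text \<open>Near each boundary point, the domain lies strictly on one side of a Lipschitz graph over the
  hyperplane orthogonal to a unit vector \<open>\<nu>\<close>; \<open>x - (x \<bullet> \<nu>) *\<^sub>R \<nu>\<close> is the projection of \<open>x\<close> onto that
  hyperplane.\<close>

definition lipschitz_boundary :: "(real^3) set \<Rightarrow> bool" where
  "lipschitz_boundary \<Omega> \<longleftrightarrow>
     (\<forall>p \<in> frontier \<Omega>. \<exists>\<epsilon>>0. \<exists>\<nu> L (\<gamma> :: real^3 \<Rightarrow> real). norm \<nu> = 1 \<and>
        L-lipschitz_on {y. y \<bullet> \<nu> = 0} \<gamma> \<and>
        \<Omega> \<inter> ball p \<epsilon> = {x \<in> ball p \<epsilon>. \<gamma> (x - (x \<bullet> \<nu>) *\<^sub>R \<nu>) < x \<bullet> \<nu>})"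

definition lipschitz_polyhedral_domain :: "(real^3) set \<Rightarrow> bool" where
  "lipschitz_polyhedral_domain \<Omega> \<longleftrightarrow>
     open \<Omega> \<and> connected \<Omega> \<and> \<Omega> \<noteq> {} \<and> bounded \<Omega> \<and> lipschitz_boundary \<Omega> \<and>
     (\<exists>P. finite P \<and> (\<forall>p\<in>P. polytope p) \<and> closure \<Omega> = \<Union>P)"

text \<open>The predicate \<open>triangulation\<close> includes conformity: any two elements meet in a common face.\<close>

definition tetrahedral_mesh :: "(real^3) set \<Rightarrow> (real^3) set set \<Rightarrow> bool" where
  "tetrahedral_mesh \<Omega> \<T> \<longleftrightarrow>
     triangulation \<T> \<and> (\<forall>T\<in>\<T>. 3 simplex T) \<and> \<Union>\<T> = closure \<Omega>"

definition mesh_size :: "(real^3) set set \<Rightarrow> real" where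
  "mesh_size \<T> = Max (diameter ` \<T>)"

definition mesh_vertices :: "(real^3) set set \<Rightarrow> (real^3) set" where
  "mesh_vertices \<T> = {z. \<exists>T\<in>\<T>. z extreme_point_of T}"

definition shape_regular_family :: "(real^3) set \<Rightarrow> (real^3) set set set \<Rightarrow> bool" where
  "shape_regular_family \<Omega> F \<longleftrightarrow>
     (\<forall>\<T>\<in>F. tetrahedral_mesh \<Omega> \<T>) \<and>
     (\<exists>\<kappa>>0. \<forall>\<T>\<in>F. \<forall>T\<in>\<T>. \<exists>c. cball c (\<kappa> * diameter T) \<subseteq> T)"

section \<open>Finite elements\<close>

text \<open>Finite element functions live on the closed domain \<open>\<Union>\<T>\<close>. They are encoded as total functions
  with value \<open>0\<close> elsewhere, so that equality of functions is equality on the closed domain. At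
  \<open>'b = real^3\<close> this is the space of triples of scalar finite element functions.\<close>

definition S1 :: "(real^3) set set \<Rightarrow> (real^3 \<Rightarrow> 'b::real_normed_vector) set" where
  "S1 \<T> = {f. continuous_on (\<Union>\<T>) f \<and>
              (\<forall>T\<in>\<T>. \<exists>A b. linear A \<and> (\<forall>x\<in>T. f x = A x + b)) \<and>
              (\<forall>x. x \<notin> \<Union>\<T> \<longrightarrow> f x = 0)}"

definition nodal_interpolant :: "(real^3) set set \<Rightarrow> (real^3 \<Rightarrow> real) \<Rightarrow> real^3 \<Rightarrow> real" where
  "nodal_interpolant \<T> f = (THE u. u \<in> S1 \<T> \<and> (\<forall>z\<in>mesh_vertices \<T>. u z = f z))"

definition L2_inner ::
    "(real^3) set \<Rightarrow> (real^3 \<Rightarrow> 'b::real_inner) \<Rightarrow> (real^3 \<Rightarrow> 'b) \<Rightarrow> real" where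
  "L2_inner \<Omega> u w = (LINT x:\<Omega>|lebesgue. u x \<bullet> w x)"

text \<open>A continuous piecewise affine function is classically differentiable off the null set of
  element faces, and its weak gradient is the classical one; the arbitrary values of \<open>jacobian\<close> on
  the faces do not affect the integral. The inner product on \<open>real^3^3\<close> is the Frobenius product.\<close>

definition grad_inner :: "(real^3) set \<Rightarrow> (real^3 \<Rightarrow> real^3) \<Rightarrow> (real^3 \<Rightarrow> real^3) \<Rightarrow> real" where
  "grad_inner \<Omega> u w = L2_inner \<Omega> (\<lambda>x. jacobian u (at x)) (\<lambda>x. jacobian w (at x))"

definition lumped_inner ::
    "(real^3) set \<Rightarrow> (real^3) set set \<Rightarrow> (real^3 \<Rightarrow> real^3) \<Rightarrow> (real^3 \<Rightarrow> real^3) \<Rightarrow> real" where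
  "lumped_inner \<Omega> \<T> \<psi> \<phi> = (LINT x:\<Omega>|lebesgue. nodal_interpolant \<T> (\<lambda>y. \<psi> y \<bullet> \<phi> y) x)"

section \<open>The tangent plane scheme\<close>

definition nonvanishing_at_vertices :: "(real^3) set set \<Rightarrow> (real^3 \<Rightarrow> real^3) \<Rightarrow> bool" where
  "nonvanishing_at_vertices \<T> m \<longleftrightarrow> (\<forall>z\<in>mesh_vertices \<T>. m z \<noteq> 0)"

definition tangent_space :: "(real^3) set set \<Rightarrow> (real^3 \<Rightarrow> real^3) \<Rightarrow> (real^3 \<Rightarrow> real^3) set" where
  "tangent_space \<T> m = {\<phi> \<in> S1 \<T>. \<forall>z\<in>mesh_vertices \<T>. m z \<bullet> \<phi> z = 0}"

text \<open>The equation for one of the two fields \<open>m\<close>, with damping \<open>\<alpha>\<close>, coefficients \<open>\<eta>\<close> and \<open>a\<close> of that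
  field, and \<open>n\<close> the other field.\<close>

definition tps_equation ::
    "(real^3) set \<Rightarrow> (real^3) set set \<Rightarrow> real \<Rightarrow> real \<Rightarrow> real \<Rightarrow> real \<Rightarrow> real \<Rightarrow> real \<Rightarrow>
     (real^3 \<Rightarrow> real^3) \<Rightarrow> (real^3 \<Rightarrow> real^3) \<Rightarrow> (real^3 \<Rightarrow> real^3) \<Rightarrow> bool" where
  "tps_equation \<Omega> \<T> \<tau> \<alpha> \<eta> a a12 a0 m n v \<longleftrightarrow>
     (\<forall>\<phi> \<in> tangent_space \<T> m.
        \<alpha> * lumped_inner \<Omega> \<T> v \<phi> + lumped_inner \<Omega> \<T> (\<lambda>x. cross3 (m x) (v x)) \<phi>
          + \<eta> * a * \<tau> * grad_inner \<Omega> v \<phi>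
        = - \<eta> * a * grad_inner \<Omega> m \<phi> - \<eta> * a12 * grad_inner \<Omega> n \<phi>
          + \<eta> * a0 * L2_inner \<Omega> n \<phi>)"

definition tps_solution ::
    "(real^3) set \<Rightarrow> (real^3) set set \<Rightarrow> real \<Rightarrow> real \<Rightarrow> real \<Rightarrow> real \<Rightarrow> real \<Rightarrow>
     real \<Rightarrow> real \<Rightarrow> real \<Rightarrow> real \<Rightarrow> (real^3 \<Rightarrow> real^3) \<Rightarrow> (real^3 \<Rightarrow> real^3) \<Rightarrow>
     (real^3 \<Rightarrow> real^3) \<Rightarrow> (real^3 \<Rightarrow> real^3) \<Rightarrow> bool" where
  "tps_solution \<Omega> \<T> \<tau> \<alpha>1 \<alpha>2 \<eta>1 \<eta>2 a11 a22 a12 a0 m1 m2 v1 v2 \<longleftrightarrow>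
     v1 \<in> tangent_space \<T> m1 \<and> v2 \<in> tangent_space \<T> m2 \<and>
     tps_equation \<Omega> \<T> \<tau> \<alpha>1 \<eta>1 a11 a12 a0 m1 m2 v1 \<and>
     tps_equation \<Omega> \<T> \<tau> \<alpha>2 \<eta>2 a22 a12 a0 m2 m1 v2"

text \<open>The sequences follow the scheme from \<open>(m10, m20)\<close> during the time steps in \<open>J\<close>: \<open>J = {..<i}\<close>
  describes the computation of the first \<open>i\<close> steps, \<open>J = UNIV\<close> a complete run.\<close>

definition tps_run ::
    "(real^3) set \<Rightarrow> (real^3) set set \<Rightarrow> real \<Rightarrow> real \<Rightarrow> real \<Rightarrow> real \<Rightarrow> real \<Rightarrow>
     real \<Rightarrow> real \<Rightarrow> real \<Rightarrow> real \<Rightarrow> (real^3 \<Rightarrow> real^3) \<Rightarrow> (real^3 \<Rightarrow> real^3) \<Rightarrow> nat set \<Rightarrow>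
     (nat \<Rightarrow> real^3 \<Rightarrow> real^3) \<Rightarrow> (nat \<Rightarrow> real^3 \<Rightarrow> real^3) \<Rightarrow>
     (nat \<Rightarrow> real^3 \<Rightarrow> real^3) \<Rightarrow> (nat \<Rightarrow> real^3 \<Rightarrow> real^3) \<Rightarrow> bool" where
  "tps_run \<Omega> \<T> \<tau> \<alpha>1 \<alpha>2 \<eta>1 \<eta>2 a11 a22 a12 a0 m10 m20 J m1 m2 v1 v2 \<longleftrightarrow>
     m1 0 = m10 \<and> m2 0 = m20 \<and>
     (\<forall>j\<in>J.
        tps_solution \<Omega> \<T> \<tau> \<alpha>1 \<alpha>2 \<eta>1 \<eta>2 a11 a22 a12 a0 (m1 j) (m2 j) (v1 j) (v2 j) \<and>
        m1 (Suc j) = (\<lambda>x. m1 j x + \<tau> *\<^sub>R v1 j x) \<and>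
        m2 (Suc j) = (\<lambda>x. m2 j x + \<tau> *\<^sub>R v2 j x))"

end

theory Submission
  imports Defs "HOL-Library.Function_Algebras"
begin

text \<open>
  Given the two current fields, the equations for the two velocities decouple. Mass lumping turns
  \<open>lumped_inner\<close> into a sum over the vertices with the integrals of the hat functions as weights,
  and these are positive. The gradient term is positive semidefinite because \<open>a11\<close> and \<open>a22\<close>
  are positive, and the cross product term vanishes on the diagonal. So each equation has a
  positive definite bilinear form on a finite-dimensional space, and is uniquely solvable.
  Tangential updates do not decrease the nodal lengths, which therefore stay at least \<open>1\<close>.
\<close>

text \<open>The other field enters (T) only at the old time level, so every term with
  \<open>a12\<close> or \<open>a0\<close> is data on the right-hand side. The gradient term cannot
  supply definiteness, because it vanishes on constant fields. Definiteness has to come from the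
  lumped mass, and this is why strict positivity of each vertex weight matters. The cross product
  makes the form nonsymmetric, so the solution is not a minimizer of a quadratic energy. It is built
  generator by generator instead, in a version of Gram-Schmidt that needs orthogonality on one side
  only. The gradient form is an integral of Jacobians whose values on element faces are arbitrary;
  rewriting it as a finite sum over elements gives both linearity and nonnegativity.\<close>

section \<open>Positive definite forms on finite-dimensional subspaces\<close>

text \<open>Bilinearity is asked on \<open>W\<close> only, since the gradient form is additive on
  finite element functions but not on arbitrary ones. Without symmetry, each argument needs its own
  linearity axioms. The parameter \<open>scale\<close> is there for the pointwise multiplication of
  functions.\<close>

locale positive_form = vector_space scale
  for scale :: "real \<Rightarrow> 'v::ab_group_add \<Rightarrow> 'v" +
  fixes W :: "'v set" and B :: "'v \<Rightarrow> 'v \<Rightarrow> real"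
  assumes subspace_W: "subspace W"
    and add_left: "\<lbrakk>x \<in> W; y \<in> W; z \<in> W\<rbrakk> \<Longrightarrow> B (x + y) z = B x z + B y z"
    and scale_left: "\<lbrakk>x \<in> W; z \<in> W\<rbrakk> \<Longrightarrow> B (scale c x) z = c * B x z"
    and add_right: "\<lbrakk>x \<in> W; y \<in> W; z \<in> W\<rbrakk> \<Longrightarrow> B z (x + y) = B z x + B z y"
    and scale_right: "\<lbrakk>x \<in> W; z \<in> W\<rbrakk> \<Longrightarrow> B z (scale c x) = c * B z x"
    and pos: "\<lbrakk>x \<in> W; x \<noteq> 0\<rbrakk> \<Longrightarrow> B x x > 0"
begin

definition functional :: "('v \<Rightarrow> real) \<Rightarrow> bool" where
  "functional f \<longleftrightarrow> (\<forall>x\<in>W. \<forall>y\<in>W. f (x + y) = f x + f y) \<and> (\<forall>c. \<forall>x\<in>W. f (scale c x) = c * f x)"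

lemma diff_left: "\<lbrakk>x \<in> W; y \<in> W; z \<in> W\<rbrakk> \<Longrightarrow> B (x - y) z = B x z - B y z"
  using add_left[of "x - y" y z] subspace_diff[OF subspace_W] by simp

text \<open>The new generator \<open>k\<close> is replaced by \<open>k - p\<close>, which is \<open>B\<close>-orthogonal to the old span on its
  left, so that its coefficient can be adjusted without spoiling the old equations.\<close>

lemma solvable_span:
  assumes "finite S" "S \<subseteq> W" "functional f"
  shows "\<exists>v\<in>span S. \<forall>w\<in>span S. B v w = f w"
  using assms
proof (induction S arbitrary: f)
  case empty
  have "0 \<in> W"
    using subspace_W by (rule subspace_0)
  then have "B 0 0 = f 0"
    using scale_left[of 0 0 0] empty unfolding functional_def by (metis mult_zero_left scale_zero_left)
  then show ?case
    by (simp add: span_empty)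
next
  case (insert k S)
  have SW: "span S \<subseteq> W" and kW: "k \<in> W"
    using insert.prems subspace_W span_minimal[of S W] by auto
  \<comment> \<open>The induction hypothesis is used twice: for \<open>B k\<close>, to find the left
    projection \<open>p\<close> of \<open>k\<close>, and for \<open>f\<close> itself. Hence
    \<open>f\<close> is arbitrary in the induction.\<close>
  have "functional (B k)"
    using kW by (auto simp: functional_def add_right scale_right)
  then obtain p where p: "p \<in> span S" "\<And>w. w \<in> span S \<Longrightarrow> B p w = B k w"
    using insert.IH insert.prems by blast
  obtain s where s: "s \<in> span S" "\<And>w. w \<in> span S \<Longrightarrow> B s w = f w"
    using insert.IH insert.prems by blast
  define q where "q = k - p"
  have qW: "q \<in> W"
    unfolding q_def using kW p SW subspace_diff[OF subspace_W] by blast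
  have qS: "B q w = 0" if "w \<in> span S" for w
    unfolding q_def using diff_left[of k p w] kW p SW that by auto
  have span_q: "\<exists>c. \<exists>t\<in>span S. x = t + scale c q" if "x \<in> span (insert k S)" for x
  proof -
    obtain c where c: "x - scale c k \<in> span S"
      using \<open>x \<in> span (insert k S)\<close> span_breakdown_eq by blast
    have "x = (x - scale c k + scale c p) + scale c q"
      by (simp add: q_def scale_right_diff_distrib)
    then show ?thesis
      using c p(1) span_add span_scale by blast
  qed
  have q_span: "q \<in> span (insert k S)"
    unfolding q_def using p(1) span_mono[of S "insert k S"]
    by (intro span_diff) (auto intro: span_base)
  \<comment> \<open>\<open>B s q\<close> need not vanish, as \<open>q\<close> is orthogonal on its
    left side only, so it is subtracted here. The case \<open>q = 0\<close> occurs exactly when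
    \<open>k\<close> already lies in \<open>span S\<close>; the old solution \<open>s\<close> then
    remains valid.\<close>
  define c where "c = (if q = 0 then 0 else (f q - B s q) / B q q)"
  have fq: "f q = B s q + c * B q q"
  proof (cases "q = 0")
    case True
    have "f (scale 0 q) = 0" "B s (scale 0 q) = 0"
      using insert.prems(2) qW s SW scale_right[of q s 0] unfolding functional_def
      by (metis mult_zero_left, auto)
    then show ?thesis
      using True by (simp add: c_def)
  next
    case False
    then show ?thesis
      using pos[OF qW] by (simp add: c_def)
  qed
  show ?case
  proof (intro bexI ballI)
    show "s + scale c q \<in> span (insert k S)"
      using s(1) q_span span_mono[of S "insert k S"] by (intro span_add span_scale) auto
    fix w assume "w \<in> span (insert k S)"
    then obtain d t where w: "t \<in> span S" "w = t + scale d q"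
      using span_q by blast
    have W: "s \<in> W" "t \<in> W" "scale c q \<in> W" "scale d q \<in> W"
      using s w SW qW subspace_scale[OF subspace_W] by auto
    have "B (s + scale c q) w = B s t + d * B s q + c * B q t + c * (d * B q q)"
      using W qW w subspace_add[OF subspace_W]
      by (simp add: add_left add_right scale_left scale_right algebra_simps)
    also have "\<dots> = f t + d * f q"
      using qS[OF w(1)] s(2)[OF w(1)] fq by (simp add: algebra_simps)
    also have "\<dots> = f w"
      using insert.prems W qW w by (auto simp: functional_def)
    finally show "B (s + scale c q) w = f w" .
  qed
qed

text \<open>The generators in \<open>S\<close> may lie outside \<open>W\<close>, where
  \<open>B\<close> is not controlled. A maximal independent subset of \<open>W\<close> spans
  \<open>W\<close> from inside, and \<open>S\<close> bounds its size. Uniqueness follows by testing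
  the difference of two solutions with itself.\<close>

lemma ex1_solution:
  assumes "finite S" "W \<subseteq> span S" "functional f"
  shows "\<exists>!v. v \<in> W \<and> (\<forall>w\<in>W. B v w = f w)"
proof -
  obtain C where C: "C \<subseteq> W" "independent C" "W \<subseteq> span C"
    using maximal_independent_subset by blast
  have "finite C"
    using independent_span_bound[OF \<open>finite S\<close> C(2)] C(1) assms(2) by blast
  moreover have "span C = W"
    using C subspace_W span_minimal by blast
  ultimately obtain v where v: "v \<in> W" "\<forall>w\<in>W. B v w = f w"
    using solvable_span[of C f] C assms(3) by auto
  have "v' = v" if v': "v' \<in> W" "\<forall>w\<in>W. B v' w = f w" for v'
  proof (rule ccontr)
    assume "v' \<noteq> v"
    moreover have "v' - v \<in> W"
      using v v' subspace_diff[OF subspace_W] by blast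
    ultimately show False
      using pos[of "v' - v"] diff_left[of v' v "v' - v"] v v' by auto
  qed
  then show ?thesis
    using v by blast
qed

end

section \<open>Nodal basis of the finite element space\<close>

lemma simplex_extreme_points:
  fixes T :: "'a::euclidean_space set"
  assumes "n simplex T"
  shows "\<not> affine_dependent {z. z extreme_point_of T}" "T = convex hull {z. z extreme_point_of T}"
proof -
  obtain C where C: "\<not> affine_dependent C" "T = convex hull C"
    using assms by (auto simp: simplex_def)
  then have "{z. z extreme_point_of T} = C"
    using extreme_point_of_convex_hull_affine_independent by auto
  then show "\<not> affine_dependent {z. z extreme_point_of T}" "T = convex hull {z. z extreme_point_of T}"
    using C by auto
qed

text \<open>Moving one point \<open>a\<close> of \<open>C\<close> to the origin turns affine into
  linear independence. The differences from \<open>a\<close> then carry prescribed values, and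
  \<open>b\<close> corrects the value at \<open>a\<close>.\<close>

lemma affine_independent_interpolation:
  fixes C :: "'a::euclidean_space set" and g :: "'a \<Rightarrow> 'b::real_vector"
  assumes "\<not> affine_dependent C"
  shows "\<exists>A b. linear A \<and> (\<forall>z\<in>C. g z = A z + b)"
proof (cases "C = {}")
  case True
  then show ?thesis
    using linear_zero by blast
next
  case False
  then obtain a where a: "a \<in> C"
    by blast
  then have "independent ((\<lambda>x. - a + x) ` (C - {a}))"
    using assms affine_dependent_iff_dependent2 by blast
  then obtain A :: "'a \<Rightarrow> 'b" where A: "linear A"
      "\<forall>y\<in>(\<lambda>x. - a + x) ` (C - {a}). A y = g (a + y) - g a"
    using linear_independent_extend[of _ "\<lambda>y. g (a + y) - g a"] by blast
  have "g z = A z + (g a - A a)" if "z \<in> C" for z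
  proof (cases "z = a")
    case False
    then have "A (- a + z) = g z - g a"
      using A(2) that by force
    moreover have "A (- a + z) = A z - A a"
      using linear_diff[OF A(1), of z a] by simp
    ultimately have "g z - g a = A z - A a"
      by metis
    then show ?thesis
      by (metis add_diff_eq add.commute diff_add_cancel)
  qed simp
  then show ?thesis
    using A(1) by blast
qed

text \<open>Used with \<open>{0}\<close> to extend equality of affine maps from vertices to hulls,
  and with \<open>{0..}\<close> to extend nonnegativity.\<close>

lemma convex_affine_vimage:
  assumes "linear A" "convex S"
  shows "convex {x. A x + b \<in> S}"
proof -
  have "{x. A x + b \<in> S} = A -` ((\<lambda>y. y - b) ` S)"
    by (force simp: image_iff)
  then show ?thesis
    using assms by (simp add: convex_linear_vimage convex_translation_subtract)
qed

lemma affine_eq_on_convex_hull: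
  fixes A A' :: "'a::real_vector \<Rightarrow> 'b::real_vector"
  assumes "linear A" "linear A'" "\<And>z. z \<in> C \<Longrightarrow> A z + b = A' z + b'" "x \<in> convex hull C"
  shows "A x + b = A' x + b'"
proof -
  have "linear (\<lambda>x. A x - A' x)"
    using assms(1,2) by (rule linear_compose_sub)
  then have "convex {x. (A x - A' x) + (b - b') \<in> {0}}"
    by (intro convex_affine_vimage) auto
  moreover have "C \<subseteq> {x. (A x - A' x) + (b - b') \<in> {0}}"
    using assms(3) by (auto simp: algebra_simps)
  ultimately have "x \<in> {x. (A x - A' x) + (b - b') \<in> {0}}"
    using assms(4) hull_minimal[of C _ convex] by blast
  then show ?thesis
    by (simp add: algebra_simps)
qed

section \<open>Closure properties of the finite element space\<close>

lemma S1_affineE: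
  assumes "f \<in> S1 \<T>" "T \<in> \<T>"
  obtains A b where "linear A" "\<forall>x\<in>T. f x = A x + b"
  using assms unfolding S1_def by blast

lemma S1_add:
  assumes "f \<in> S1 \<T>" "g \<in> S1 \<T>"
  shows "(\<lambda>x. f x + g x) \<in> S1 \<T>"
proof -
  have "\<exists>A b. linear A \<and> (\<forall>x\<in>T. f x + g x = A x + b)" if "T \<in> \<T>" for T
  proof -
    obtain A b where "linear A" "\<forall>x\<in>T. f x = A x + b"
      by (rule S1_affineE[OF assms(1) \<open>T \<in> \<T>\<close>])
    moreover obtain A' b' where "linear A'" "\<forall>x\<in>T. g x = A' x + b'"
      by (rule S1_affineE[OF assms(2) \<open>T \<in> \<T>\<close>])
    ultimately show ?thesis
      by (intro exI[of _ "\<lambda>x. A x + A' x"] exI[of _ "b + b'"])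
        (auto simp: linear_compose_add algebra_simps)
  qed
  then show ?thesis
    using assms by (auto simp: S1_def intro: continuous_on_add)
qed

lemma S1_bounded_linear:
  assumes "f \<in> S1 \<T>" "bounded_linear L"
  shows "(\<lambda>x. L (f x)) \<in> S1 \<T>"
proof -
  have L: "linear L"
    using assms(2) by (rule bounded_linear.linear)
  have "\<exists>A b. linear A \<and> (\<forall>x\<in>T. L (f x) = A x + b)" if "T \<in> \<T>" for T
  proof -
    obtain A b where "linear A" "\<forall>x\<in>T. f x = A x + b"
      by (rule S1_affineE[OF assms(1) \<open>T \<in> \<T>\<close>])
    then show ?thesis
      using L by (intro exI[of _ "L \<circ> A"] exI[of _ "L b"])
        (auto simp: linear_compose linear_add)
  qed
  then show ?thesis
    using assms L by (auto simp: S1_def linear_0 intro: bounded_linear.continuous_on)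
qed

lemma S1_zero: "(\<lambda>x. 0) \<in> S1 \<T>"
  by (auto simp: S1_def intro!: exI[of _ "\<lambda>x. 0"] linear_zero)

lemma S1_scaleR: "f \<in> S1 \<T> \<Longrightarrow> (\<lambda>x. c *\<^sub>R f x) \<in> S1 \<T>"
  by (rule S1_bounded_linear[OF _ bounded_linear_scaleR_right])

lemma S1_sum: "(\<And>i. i \<in> I \<Longrightarrow> f i \<in> S1 \<T>) \<Longrightarrow> (\<lambda>x. \<Sum>i\<in>I. f i x) \<in> S1 \<T>"
  by (induction I rule: infinite_finite_induct) (auto intro: S1_zero S1_add)

section \<open>Unisolvence of vertex values and hat functions\<close>

locale simplicial_mesh =
  fixes \<T> :: "(real^3) set set"
  assumes triangulation: "triangulation \<T>"
begin

abbreviation vertices :: "(real^3) set" where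
  "vertices \<equiv> mesh_vertices \<T>"

lemma finite_mesh: "finite \<T>"
  using triangulation by (simp add: triangulation_def)

lemma element_hull:
  assumes "T \<in> \<T>"
  shows "T = convex hull {z. z extreme_point_of T}"
    "\<not> affine_dependent {z. z extreme_point_of T}"
proof -
  obtain n where "n simplex T"
    using triangulation assms by (auto simp: triangulation_def)
  then show "T = convex hull {z. z extreme_point_of T}" "\<not> affine_dependent {z. z extreme_point_of T}"
    by (auto dest: simplex_extreme_points)
qed

lemma compact_element: "T \<in> \<T> \<Longrightarrow> compact T"
  and convex_element: "T \<in> \<T> \<Longrightarrow> convex T"
  using triangulation unfolding triangulation_def
  by (meson polytope_imp_compact simplex_imp_polytope, meson polytope_imp_convex simplex_imp_polytope)

lemma vertices_subset: "vertices \<subseteq> \<Union>\<T>"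
  by (auto simp: mesh_vertices_def extreme_point_of_def)

lemma finite_vertices: "finite vertices"
proof -
  have "vertices = (\<Union>T\<in>\<T>. {z. z extreme_point_of T})"
    by (auto simp: mesh_vertices_def)
  then show ?thesis
    using finite_mesh element_hull(2) aff_independent_finite by auto
qed

lemma common_face:
  assumes "T \<in> \<T>" "T' \<in> \<T>"
  shows "T \<inter> T' face_of T" "T \<inter> T' face_of T'"
  using triangulation assms unfolding triangulation_def by (blast, metis Int_commute)

text \<open>This is where conformity enters: \<open>T \<inter> T'\<close> is a face of both
  elements, so its extreme points are vertices of both, and by Krein-Milman they span it convexly.
  With \<open>T = T'\<close> it shows that vertex values determine an affine function; with distinct
  elements it glues local ones.\<close>

lemma affine_agree:
  assumes "T \<in> \<T>" "T' \<in> \<T>" "x \<in> T" "x \<in> T'" "linear A" "linear A'"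
    and "\<And>z. z extreme_point_of T \<Longrightarrow> z extreme_point_of T' \<Longrightarrow> A z + b = A' z + b'"
  shows "A x + b = A' x + b'"
proof (rule affine_eq_on_convex_hull[OF assms(5,6)])
  let ?F = "T \<inter> T'"
  show "x \<in> convex hull {z. z extreme_point_of ?F}"
    using Krein_Milman_Minkowski[of ?F] assms(1-4) compact_element convex_element
    by (auto simp: convex_Int compact_Int)
  show "A z + b = A' z + b'" if "z \<in> {z. z extreme_point_of ?F}" for z
    using that extreme_point_of_face[OF common_face(1)[OF assms(1,2)]]
      extreme_point_of_face[OF common_face(2)[OF assms(1,2)]] assms(7) by auto
qed

lemma S1_eqI:
  fixes f g :: "real^3 \<Rightarrow> 'b::real_normed_vector"
  assumes "f \<in> S1 \<T>" "g \<in> S1 \<T>" "\<And>z. z \<in> vertices \<Longrightarrow> f z = g z"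
  shows "f = g"
proof
  fix x
  show "f x = g x"
  proof (cases "x \<in> \<Union>\<T>")
    case True
    then obtain T where T: "T \<in> \<T>" "x \<in> T"
      by blast
    obtain A b where A: "linear A" "\<forall>x\<in>T. f x = A x + b"
      by (rule S1_affineE[OF assms(1) T(1)])
    obtain A' b' where A': "linear A'" "\<forall>x\<in>T. g x = A' x + b'"
      by (rule S1_affineE[OF assms(2) T(1)])
    have "z \<in> T \<and> z \<in> vertices" if "z extreme_point_of T" for z
      using that T(1) by (auto simp: mesh_vertices_def extreme_point_of_def)
    then have "A x + b = A' x + b'"
      using A A' assms(3) by (intro affine_agree[OF T(1) T(1) T(2) T(2) A(1) A'(1)]) metis
    then show ?thesis
      using A(2) A'(2) T(2) by metis
  next
    case False
    then show ?thesis
      using assms(1,2) by (simp add: S1_def)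
  qed
qed

lemma S1_interpolation:
  fixes g :: "real^3 \<Rightarrow> 'b::real_normed_vector"
  shows "\<exists>u\<in>S1 \<T>. \<forall>z\<in>vertices. u z = g z"
proof -
  have "\<forall>T\<in>\<T>. \<exists>A b. linear A \<and> (\<forall>z\<in>{z. z extreme_point_of T}. g z = A z + b)"
    using affine_independent_interpolation element_hull(2) by blast
  then obtain A where "\<forall>T\<in>\<T>. \<exists>b. linear (A T) \<and> (\<forall>z\<in>{z. z extreme_point_of T}. g z = A T z + b)"
    by (rule bchoice[THEN exE])
  then obtain b where "\<forall>T\<in>\<T>. linear (A T) \<and> (\<forall>z\<in>{z. z extreme_point_of T}. g z = A T z + b T)"
    by (rule bchoice[THEN exE])
  then have A: "\<And>T. T \<in> \<T> \<Longrightarrow> linear (A T)"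
      "\<And>T z. \<lbrakk>T \<in> \<T>; z extreme_point_of T\<rbrakk> \<Longrightarrow> g z = A T z + b T"
    by simp_all
  \<comment> \<open>On a shared face an arbitrary element is selected; \<open>affine_agree\<close>
    makes the value independent of this selection.\<close>
  define u where
    "u x = (if x \<in> \<Union>\<T> then (let T = SOME T. T \<in> \<T> \<and> x \<in> T in A T x + b T) else 0)" for x
  have u: "u x = A T x + b T" if T: "T \<in> \<T>" "x \<in> T" for x T
  proof -
    define T' where "T' = (SOME T. T \<in> \<T> \<and> x \<in> T)"
    have T': "T' \<in> \<T>" "x \<in> T'"
      unfolding T'_def using someI[of "\<lambda>T. T \<in> \<T> \<and> x \<in> T" T] T by blast+
    have "u x = A T' x + b T'"
      using T by (auto simp: u_def T'_def Let_def)
    also have "\<dots> = A T x + b T"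
    proof (rule affine_agree[OF T'(1) T(1) T'(2) T(2)])
      show "A T' z + b T' = A T z + b T" if "z extreme_point_of T'" "z extreme_point_of T" for z
        using A(2)[OF T'(1) that(1)] A(2)[OF T(1) that(2)] by simp
    qed (use A T T' in auto)
    finally show ?thesis .
  qed
  have "continuous_on (\<Union>\<T>) u"
  proof (rule continuous_on_closed_Union[where U = "\<lambda>T. T" and I = \<T>, simplified])
    show "finite \<T>"
      by (rule finite_mesh)
    show "closed T" if "T \<in> \<T>" for T
      using that compact_element compact_imp_closed by blast
    show "continuous_on T u" if "T \<in> \<T>" for T
    proof -
      have "continuous_on T (\<lambda>x. A T x + b T)"
        using A(1)[OF that] by (intro continuous_intros linear_continuous_on linear_conv_bounded_linear[THEN iffD1])
      then show ?thesis
        using u that by (simp cong: continuous_on_cong)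
    qed
  qed
  then have "u \<in> S1 \<T>"
    using u A(1) by (auto simp: S1_def u_def)
  moreover have "u z = g z" if "z \<in> vertices" for z
    using that u A(2) by (auto simp: mesh_vertices_def extreme_point_of_def)
  ultimately show ?thesis
    by blast
qed

lemma nodal_interpolant:
  shows nodal_interpolant_S1: "nodal_interpolant \<T> f \<in> S1 \<T>"
    and nodal_interpolant_vertex: "z \<in> vertices \<Longrightarrow> nodal_interpolant \<T> f z = f z"
proof -
  have "\<exists>!u. u \<in> S1 \<T> \<and> (\<forall>z\<in>vertices. u z = f z)"
    using S1_interpolation[of f] by (auto intro!: ex_ex1I S1_eqI)
  from theI'[OF this] show "nodal_interpolant \<T> f \<in> S1 \<T>"
    "z \<in> vertices \<Longrightarrow> nodal_interpolant \<T> f z = f z"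
    unfolding nodal_interpolant_def by auto
qed

text \<open>Interpolating a discontinuous indicator is legitimate, since the interpolant sees vertex
  values only. If \<open>z\<close> is not a vertex, \<open>hat z\<close> is the zero
  function.\<close>

definition hat :: "real^3 \<Rightarrow> real^3 \<Rightarrow> real" where
  "hat z = nodal_interpolant \<T> (indicator {z})"

lemma hat_S1: "hat z \<in> S1 \<T>"
  by (simp add: hat_def nodal_interpolant_S1)

lemma hat_vertex: "y \<in> vertices \<Longrightarrow> hat z y = indicator {z} y"
  by (simp add: hat_def nodal_interpolant_vertex)

text \<open>On each element the function is affine with vertex values 0 or 1, and the preimage of a
  half-line under an affine map is convex.\<close>

lemma hat_nonneg: "hat z x \<ge> 0"
proof (cases "x \<in> \<Union>\<T>")
  case True
  then obtain T where T: "T \<in> \<T>" "x \<in> T"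
    by blast
  obtain A b where A: "linear A" "\<forall>x\<in>T. hat z x = A x + b"
    using hat_S1[of z] T(1) unfolding S1_def by blast
  have "{y. y extreme_point_of T} \<subseteq> {x. A x + b \<in> {0..}}"
  proof
    fix y assume y: "y \<in> {y. y extreme_point_of T}"
    then have "y \<in> T" "y \<in> vertices"
      using T(1) by (auto simp: mesh_vertices_def extreme_point_of_def)
    then show "y \<in> {x. A x + b \<in> {0..}}"
      using hat_vertex[of y z] A(2) by (auto simp: indicator_def split: if_splits)
  qed
  then have "convex hull {y. y extreme_point_of T} \<subseteq> {x. A x + b \<in> {0..}}"
    using A(1) by (intro hull_minimal convex_affine_vimage) auto
  then have "x \<in> {x. A x + b \<in> {0..}}"
    using T(2) element_hull(1)[OF T(1)] by blast
  then show ?thesis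
    using A(2) T(2) by simp
next
  case False
  then show ?thesis
    using hat_S1[of z] by (simp add: S1_def)
qed

lemma S1_expansion:
  fixes f :: "real^3 \<Rightarrow> 'b::real_normed_vector"
  assumes "f \<in> S1 \<T>"
  shows "f = (\<lambda>x. \<Sum>z\<in>vertices. hat z x *\<^sub>R f z)"
proof (rule S1_eqI[OF assms])
  show "(\<lambda>x. \<Sum>z\<in>vertices. hat z x *\<^sub>R f z) \<in> S1 \<T>"
    by (intro S1_sum S1_bounded_linear[OF hat_S1] bounded_linear_scaleR_left)
  show "f y = (\<Sum>z\<in>vertices. hat z y *\<^sub>R f z)" if "y \<in> vertices" for y
  proof -
    have "(\<Sum>z\<in>vertices. hat z y *\<^sub>R f z) = (\<Sum>z\<in>vertices. if z = y then f z else 0)"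
      using that by (intro sum.cong) (auto simp: hat_vertex indicator_def)
    then show ?thesis
      using that finite_vertices by simp
  qed
qed

lemma nodal_interpolant_expansion: "nodal_interpolant \<T> f x = (\<Sum>z\<in>vertices. hat z x * f z)"
  using fun_cong[OF S1_expansion[OF nodal_interpolant_S1[of f]], of x]
  by (simp add: nodal_interpolant_vertex)

end

section \<open>Bilinear forms of the scheme\<close>

text \<open>Two sets appear because finite element functions are continuous on the closed domain,
  while the integrals run over the open one.\<close>

lemma set_integrable_continuous_compact:
  fixes f :: "'a::euclidean_space \<Rightarrow> real"
  assumes "compact K" "continuous_on K f" "S \<subseteq> K" "S \<in> sets lebesgue"
  shows "set_integrable lebesgue S f"
proof (rule set_integrable_subset[OF _ assms(4,3)])
  have "integrable lborel (\<lambda>x. indicator K x *\<^sub>R f x)"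
    using assms(1,2) by (rule borel_integrable_compact)
  then show "set_integrable lebesgue K f"
    unfolding set_integrable_def
    by (subst integrable_completion) (auto dest: borel_measurable_integrable)
qed

lemma jacobian_affine:
  fixes f :: "real^'n \<Rightarrow> real^'m"
  assumes "x \<in> interior T" "linear A" "\<forall>y\<in>T. f y = A y + b"
  shows "jacobian f (at x) = matrix A"
proof -
  have "((\<lambda>y. A y + b) has_derivative A) (at x)"
    using assms(2) by (auto intro!: derivative_eq_intros linear_imp_has_derivative)
  then have "(f has_derivative A) (at x)"
    using assms(1,3) interior_subset[of T]
    by (elim has_derivative_transform_within_open[OF _ open_interior[of T]]) auto
  then show ?thesis
    unfolding jacobian_def using frechet_derivative_at by metis
qed

lemma matrix_scaleR_linear:
  fixes A :: "real^'n \<Rightarrow> real^'m"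
  shows "matrix (\<lambda>x. c *\<^sub>R A x) = c *\<^sub>R matrix A"
  by (simp add: matrix_def vec_eq_iff)

lemma matrix_add_linear:
  fixes A A' :: "real^'n \<Rightarrow> real^'m"
  shows "matrix (\<lambda>x. A x + A' x) = matrix A + matrix A'"
  by (simp add: matrix_def vec_eq_iff)

section \<open>Mass lumping as vertex quadrature\<close>

locale domain_mesh = simplicial_mesh +
  fixes \<Omega> :: "(real^3) set"
  assumes open_domain: "open \<Omega>"
    and mesh_Union: "\<Union>\<T> = closure \<Omega>"
    and tetrahedra: "T \<in> \<T> \<Longrightarrow> 3 simplex T"
begin

lemma compact_Union: "compact (\<Union>\<T>)"
  using finite_mesh compact_element by (rule compact_Union)

lemma domain_subset: "\<Omega> \<subseteq> \<Union>\<T>"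
  using mesh_Union closure_subset by auto

lemma domain_sets: "\<Omega> \<in> sets lebesgue"
  using open_domain by simp

lemma set_integrable_continuous: "continuous_on (\<Union>\<T>) f \<Longrightarrow> set_integrable lebesgue \<Omega> f"
  for f :: "real^3 \<Rightarrow> real"
  using set_integrable_continuous_compact[OF compact_Union _ domain_subset domain_sets] .

lemma continuous_S1: "f \<in> S1 \<T> \<Longrightarrow> continuous_on (\<Union>\<T>) f"
  by (simp add: S1_def)

definition weight :: "real^3 \<Rightarrow> real" where
  "weight z = (LINT x:\<Omega>|lebesgue. hat z x)"

text \<open>Only vertex values of the product enter, so the formula also covers the pointwise cross
  product of two finite element functions, which in general is not piecewise affine.\<close>

lemma lumped_inner_eq: "lumped_inner \<Omega> \<T> \<psi> \<phi> = (\<Sum>z\<in>vertices. weight z * (\<psi> z \<bullet> \<phi> z))"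
proof -
  have int: "set_integrable lebesgue \<Omega> (hat z)" for z
    by (intro set_integrable_continuous continuous_S1 hat_S1)
  have "lumped_inner \<Omega> \<T> \<psi> \<phi>
      = integral\<^sup>L lebesgue (\<lambda>x. \<Sum>z\<in>vertices. (indicator \<Omega> x *\<^sub>R hat z x) * (\<psi> z \<bullet> \<phi> z))"
    unfolding lumped_inner_def set_lebesgue_integral_def nodal_interpolant_expansion
    by (simp add: sum_distrib_left mult.assoc)
  also have "\<dots> = (\<Sum>z\<in>vertices. weight z * (\<psi> z \<bullet> \<phi> z))"
    using int unfolding set_integrable_def weight_def set_lebesgue_integral_def
    by (subst Bochner_Integration.integral_sum) auto
  finally show ?thesis .
qed

text \<open>A hat function with vanishing integral would vanish almost everywhere on \<open>\<Omega>\<close>, hence by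
  continuity on all of \<open>closure \<Omega>\<close>, although it is \<open>1\<close> at its vertex.\<close>

lemma weight_pos:
  assumes "z \<in> vertices"
  shows "weight z > 0"
proof -
  have int: "integrable lebesgue (\<lambda>x. indicator \<Omega> x *\<^sub>R hat z x)"
    using set_integrable_continuous[OF continuous_S1[OF hat_S1]] by (simp add: set_integrable_def)
  have nonneg: "weight z \<ge> 0"
    unfolding weight_def set_lebesgue_integral_def
    by (rule Bochner_Integration.integral_nonneg) (simp add: hat_nonneg)
  have "weight z \<noteq> 0"
  proof
    assume "weight z = 0"
    then have "AE x in lebesgue. indicator \<Omega> x *\<^sub>R hat z x = 0"
      using integral_nonneg_eq_0_iff_AE[OF int] hat_nonneg
      unfolding weight_def set_lebesgue_integral_def by auto
    then have "negligible {x. indicator \<Omega> x *\<^sub>R hat z x \<noteq> 0}"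
      by (simp add: negligible_iff_null_sets completion.AE_iff_null_sets eventually_ae_filter)
         (metis (no_types, lifting) completion.complete2 mem_Collect_eq subsetI)
    moreover have "{x. indicator \<Omega> x *\<^sub>R hat z x \<noteq> 0} = \<Omega> \<inter> hat z -` (- {0})"
      by (auto simp: indicator_def)
    moreover have "open (\<Omega> \<inter> hat z -` (- {0}))"
      using continuous_on_subset[OF continuous_S1[OF hat_S1] domain_subset] open_domain
      by (intro continuous_open_preimage) auto
    ultimately have "\<Omega> \<inter> hat z -` (- {0}) = {}"
      using open_not_negligible by metis
    then have zero: "\<And>x. x \<in> \<Omega> \<Longrightarrow> hat z x = 0"
      by auto
    have "hat z x = 0" if "x \<in> closure \<Omega>" for x
      using continuous_S1[OF hat_S1, of z] zero that unfolding mesh_Union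
      by (rule continuous_constant_on_closure)
    then show False
      using assms vertices_subset mesh_Union hat_vertex[OF assms, of z] by auto
  qed
  then show ?thesis
    using nonneg by simp
qed

section \<open>Elementwise constant gradients\<close>

lemma interior_nonempty:
  assumes "T \<in> \<T>"
  shows "interior T \<noteq> {}"
proof -
  have "aff_dim T = 3"
    using tetrahedra[OF assms] by (rule aff_dim_simplex)
  then have "affine hull T = UNIV" "T \<noteq> {}"
    using aff_dim_eq_full[of T] by auto
  then show ?thesis
    using rel_interior_interior[of T] rel_interior_eq_empty[of T] convex_element[OF assms] by simp
qed

text \<open>For \<open>f\<close> in \<open>S1\<close> the Jacobian is constant on the interior of
  \<open>T\<close>, so any interior point may represent it. This makes the element gradient a
  function of \<open>f\<close> without a choice of affine data.\<close>

definition grad :: "(real^3) set \<Rightarrow> (real^3 \<Rightarrow> real^3) \<Rightarrow> real^3^3" where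
  "grad T f = jacobian f (at (SOME x. x \<in> interior T))"

lemma grad_eq:
  assumes "T \<in> \<T>" "linear A" "\<forall>y\<in>T. f y = A y + b"
  shows "grad T f = matrix A"
proof -
  have "(SOME x. x \<in> interior T) \<in> interior T"
    using interior_nonempty[OF assms(1)] by (simp add: some_in_eq)
  then show ?thesis
    unfolding grad_def using assms(2,3) by (rule jacobian_affine)
qed

lemma jacobian_eq_grad:
  assumes "f \<in> S1 \<T>" "T \<in> \<T>" "x \<in> interior T"
  shows "jacobian f (at x) = grad T f"
proof -
  obtain A b where A: "linear A" "\<forall>y\<in>T. f y = A y + b"
    by (rule S1_affineE[OF assms(1,2)])
  then show ?thesis
    using jacobian_affine[OF assms(3) A] grad_eq[OF assms(2) A] by simp
qed

lemma grad_add: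
  assumes "f \<in> S1 \<T>" "g \<in> S1 \<T>" "T \<in> \<T>"
  shows "grad T (\<lambda>x. f x + g x) = grad T f + grad T g"
proof -
  obtain A b where A: "linear A" "\<forall>y\<in>T. f y = A y + b"
    by (rule S1_affineE[OF assms(1,3)])
  obtain A' b' where A': "linear A'" "\<forall>y\<in>T. g y = A' y + b'"
    by (rule S1_affineE[OF assms(2,3)])
  have "grad T (\<lambda>x. f x + g x) = matrix (\<lambda>x. A x + A' x)"
    using A A' assms(3)
    by (intro grad_eq[where b = "b + b'"]) (auto simp: linear_compose_add algebra_simps)
  then show ?thesis
    using grad_eq[OF assms(3) A] grad_eq[OF assms(3) A'] by (simp add: matrix_add_linear)
qed

lemma grad_scaleR:
  assumes "f \<in> S1 \<T>" "T \<in> \<T>"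
  shows "grad T (\<lambda>x. c *\<^sub>R f x) = c *\<^sub>R grad T f"
proof -
  obtain A b where A: "linear A" "\<forall>y\<in>T. f y = A y + b"
    by (rule S1_affineE[OF assms])
  have "grad T (\<lambda>x. c *\<^sub>R f x) = matrix (\<lambda>x. c *\<^sub>R A x)"
    using A assms(2)
    by (intro grad_eq[where b = "c *\<^sub>R b"]) (auto simp: linear_compose_scale_right algebra_simps)
  then show ?thesis
    using grad_eq[OF assms(2) A] by (simp add: matrix_scaleR_linear)
qed

text \<open>A proper face misses the interior, so the common face \<open>T \<inter> T'\<close> must
  be all of \<open>T\<close> and all of \<open>T'\<close>.\<close>

lemma interiors_disjoint:
  assumes "T \<in> \<T>" "T' \<in> \<T>" "x \<in> interior T" "x \<in> interior T'"
  shows "T = T'"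
proof -
  have "x \<in> T \<inter> T'"
    using assms(3,4) interior_subset by blast
  then have "T \<inter> T' = T" "T \<inter> T' = T'"
    using common_face[OF assms(1,2)] face_of_disjoint_interior assms(3,4) by blast+
  then show ?thesis
    by simp
qed

text \<open>Frontiers of convex sets are negligible, and off them both Jacobians are elementwise
  constant. The weights use \<open>interior T \<inter> \<Omega>\<close> because openness of
  \<open>\<Omega>\<close> alone does not place \<open>interior T\<close> inside it.\<close>

lemma grad_inner_eq:
  assumes "f \<in> S1 \<T>" "g \<in> S1 \<T>"
  shows "grad_inner \<Omega> f g = (\<Sum>T\<in>\<T>. measure lebesgue (interior T \<inter> \<Omega>) * (grad T f \<bullet> grad T g))"
proof -
  let ?J = "\<lambda>x. indicator \<Omega> x *\<^sub>R (jacobian f (at x) \<bullet> jacobian g (at x))"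
  let ?h = "\<lambda>x. \<Sum>T\<in>\<T>. indicator (interior T \<inter> \<Omega>) x *\<^sub>R (grad T f \<bullet> grad T g)"
  have "bounded \<Omega>"
    using compact_imp_bounded[OF compact_Union] domain_subset bounded_subset by blast
  have h: "has_bochner_integral lebesgue ?h
      (\<Sum>T\<in>\<T>. measure lebesgue (interior T \<inter> \<Omega>) *\<^sub>R (grad T f \<bullet> grad T g))"
  proof (intro has_bochner_integral_sum has_bochner_integral_indicator)
    fix T assume "T \<in> \<T>"
    have "interior T \<inter> \<Omega> \<in> lmeasurable"
      using open_domain \<open>bounded \<Omega>\<close> by (intro lmeasurable_open) (auto simp: bounded_Int)
    then show "interior T \<inter> \<Omega> \<in> sets lebesgue" "emeasure lebesgue (interior T \<inter> \<Omega>) < \<infinity>"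
      by (auto simp: fmeasurable_def)
  qed
  have "negligible (\<Union>T\<in>\<T>. frontier T)"
    using finite_mesh convex_element by (intro negligible_Union) (auto intro: negligible_convex_frontier)
  then have "AE x in lebesgue. x \<notin> (\<Union>T\<in>\<T>. frontier T)"
    by (intro AE_not_in) (simp add: negligible_iff_null_sets)
  then have ae: "AE x in lebesgue. ?h x = ?J x"
  proof eventually_elim
    case (elim x)
    show ?case
    proof (cases "x \<in> \<Omega>")
      case True
      then obtain T where T: "T \<in> \<T>" "x \<in> T"
        using domain_subset by blast
      then have x: "x \<in> interior T"
        using elim closure_subset by (auto simp: frontier_def)
      have "?h x = (\<Sum>T'\<in>\<T>. if T' = T then grad T f \<bullet> grad T g else 0)"
        using True T(1) x interiors_disjoint by (intro sum.cong) (auto simp: indicator_def)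
      also have "\<dots> = ?J x"
        using T(1) x True finite_mesh jacobian_eq_grad[OF assms(1)] jacobian_eq_grad[OF assms(2)]
        by simp
      finally show ?thesis .
    qed simp
  qed
  have hm: "?h \<in> borel_measurable lebesgue"
    using h by (rule borel_measurable_has_bochner_integral)
  \<comment> \<open>The values of \<open>?J\<close> on the frontiers are uncontrolled; completeness
    of Lebesgue measure still gives measurability, from the almost everywhere equality with
    \<open>?h\<close>.\<close>
  moreover have "?J \<in> borel_measurable lebesgue"
    using hm ae by (rule borel_measurable_AE)
  ultimately have "integral\<^sup>L lebesgue ?J = integral\<^sup>L lebesgue ?h"
    using ae by (intro integral_cong_AE) (auto elim: eventually_mono)
  then show ?thesis
    using has_bochner_integral_integral_eq[OF h]
    by (simp add: grad_inner_def L2_inner_def set_lebesgue_integral_def)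
qed

lemma grad_inner_add_right:
  assumes "f \<in> S1 \<T>" "g \<in> S1 \<T>" "h \<in> S1 \<T>"
  shows "grad_inner \<Omega> f (\<lambda>x. g x + h x) = grad_inner \<Omega> f g + grad_inner \<Omega> f h"
  using assms by (simp add: grad_inner_eq S1_add grad_add inner_add_right distrib_left sum.distrib)

lemma grad_inner_scaleR_right:
  assumes "f \<in> S1 \<T>" "g \<in> S1 \<T>"
  shows "grad_inner \<Omega> f (\<lambda>x. c *\<^sub>R g x) = c * grad_inner \<Omega> f g"
  using assms by (simp add: grad_inner_eq S1_scaleR grad_scaleR sum_distrib_left algebra_simps)

text \<open>Reduces linearity in the left argument to the lemmas for the right one.\<close>

lemma grad_inner_commute: "grad_inner \<Omega> f g = grad_inner \<Omega> g f"
  by (simp add: grad_inner_def L2_inner_def inner_commute)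

lemma grad_inner_nonneg: "f \<in> S1 \<T> \<Longrightarrow> grad_inner \<Omega> f f \<ge> 0"
  by (simp add: grad_inner_eq sum_nonneg)

lemma L2_inner_add_right:
  assumes "f \<in> S1 \<T>" "g \<in> S1 \<T>" "h \<in> S1 \<T>"
  shows "L2_inner \<Omega> f (\<lambda>x. g x + h x) = L2_inner \<Omega> f g + L2_inner \<Omega> f h"
proof -
  have "set_integrable lebesgue \<Omega> (\<lambda>x. f x \<bullet> g x)" "set_integrable lebesgue \<Omega> (\<lambda>x. f x \<bullet> h x)"
    using assms by (auto intro: set_integrable_continuous continuous_on_inner dest: continuous_S1)
  then show ?thesis
    by (simp add: L2_inner_def inner_add_right)
qed

lemma L2_inner_scaleR_right: "L2_inner \<Omega> f (\<lambda>x. c *\<^sub>R g x) = c * L2_inner \<Omega> f g"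
  by (simp add: L2_inner_def)

text \<open>A nonzero finite element function is nonzero at some vertex, and that vertex has
  positive weight.\<close>

lemma lumped_inner_self_pos:
  assumes "\<phi> \<in> S1 \<T>" "\<phi> \<noteq> (\<lambda>x. 0)"
  shows "lumped_inner \<Omega> \<T> \<phi> \<phi> > 0"
proof -
  obtain z where "z \<in> vertices" "\<phi> z \<noteq> 0"
    using S1_eqI[OF assms(1) S1_zero] assms(2) by blast
  then show ?thesis
    unfolding lumped_inner_eq using finite_vertices weight_pos
    by (intro sum_pos2[of _ z]) (auto simp: less_imp_le)
qed

text \<open>Supplies the finite generating set: hat functions times coordinate vectors. These need
  not be tangential, so for the tangent space this is only an enclosing span.\<close>

lemma S1_subset_span:
  fixes scale :: "real \<Rightarrow> (real^3 \<Rightarrow> 'b::euclidean_space) \<Rightarrow> real^3 \<Rightarrow> 'b"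
  defines "scale \<equiv> \<lambda>c f x. c *\<^sub>R f x"
  shows "S1 \<T> \<subseteq> module.span scale ((\<lambda>(z, b) x. hat z x *\<^sub>R b) ` (vertices \<times> Basis))"
proof -
  interpret vector_space scale
    unfolding scale_def by unfold_locales (auto simp: fun_eq_iff algebra_simps)
  let ?G = "(\<lambda>(z, b) x. hat z x *\<^sub>R b) ` (vertices \<times> (Basis :: 'b set))"
  have sum_apply: "sum F I x = (\<Sum>i\<in>I. F i x)" for F :: "'i \<Rightarrow> real^3 \<Rightarrow> 'b" and I x
    by (induction I rule: infinite_finite_induct) auto
  show ?thesis
  proof
    fix f :: "real^3 \<Rightarrow> 'b"
    assume "f \<in> S1 \<T>"
    then have "f = (\<lambda>x. \<Sum>z\<in>vertices. hat z x *\<^sub>R f z)"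
      by (rule S1_expansion)
    also have "\<dots> = (\<lambda>x. \<Sum>z\<in>vertices. \<Sum>b\<in>Basis. (f z \<bullet> b) *\<^sub>R hat z x *\<^sub>R b)"
    proof (intro ext sum.cong refl)
      fix x z
      have "hat z x *\<^sub>R f z = hat z x *\<^sub>R (\<Sum>b\<in>Basis. (f z \<bullet> b) *\<^sub>R b)"
        by (simp only: euclidean_representation)
      then show "hat z x *\<^sub>R f z = (\<Sum>b\<in>Basis. (f z \<bullet> b) *\<^sub>R hat z x *\<^sub>R b)"
        by (simp add: scaleR_sum_right mult.commute)
    qed
    also have "\<dots> = (\<Sum>z\<in>vertices. \<Sum>b\<in>Basis. scale (f z \<bullet> b) (\<lambda>x. hat z x *\<^sub>R b))"
      by (simp add: fun_eq_iff sum_apply scale_def)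
    also have "\<dots> \<in> span ?G"
      by (intro span_sum span_scale span_base) auto
    finally show "f \<in> span ?G" .
  qed
qed

end

section \<open>Solvability of the scheme\<close>

lemma ex1_pair:
  assumes "\<exists>!x. P x" "\<exists>!y. Q y"
  shows "\<exists>!(x, y). P x \<and> Q y"
proof -
  obtain x where x: "P x" "\<forall>x'. P x' \<longrightarrow> x' = x"
    using assms(1) by (rule ex1E)
  obtain y where y: "Q y" "\<forall>y'. Q y' \<longrightarrow> y' = y"
    using assms(2) by (rule ex1E)
  show ?thesis
  proof (rule ex1I[of _ "(x, y)"])
    show "p = (x, y)" if "case p of (x, y) \<Rightarrow> P x \<and> Q y" for p
      using that x(2) y(2) by (cases p) simp
  qed (simp add: x(1) y(1))
qed

text \<open>The invariant \<open>I\<close> guarantees that the description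
  \<open>THE v. R s v\<close> is meaningful at every state reached, so the run can be defined by
  recursion.\<close>

lemma deterministic_run_ex1:
  fixes R :: "'s \<Rightarrow> 'v \<Rightarrow> bool"
  assumes "I s0" "\<And>s. I s \<Longrightarrow> \<exists>!v. R s v" "\<And>s v. \<lbrakk>I s; R s v\<rbrakk> \<Longrightarrow> I (f s v)"
  shows "\<exists>!(s, v). s 0 = s0 \<and> (\<forall>j::nat. R (s j) (v j) \<and> s (Suc j) = f (s j) (v j))"
proof -
  define s where "s = rec_nat s0 (\<lambda>_ s. f s (THE v. R s v))"
  have s: "s 0 = s0" "s (Suc j) = f (s j) (THE v. R (s j) v)" for j
    by (simp_all add: s_def)
  have I: "I (s j)" for j
  proof (induction j)
    case (Suc j)
    then show ?case
      unfolding s(2) by (intro assms(3) theI'[OF assms(2)])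
  qed (simp add: s assms(1))
  have R: "R (s j) (THE v. R (s j) v)" for j
    by (rule theI'[OF assms(2)[OF I]])
  show ?thesis
  proof (rule ex1I[of _ "(s, \<lambda>j. THE v. R (s j) v)"])
    show "case (s, \<lambda>j. THE v. R (s j) v) of
        (s, v) \<Rightarrow> s 0 = s0 \<and> (\<forall>j. R (s j) (v j) \<and> s (Suc j) = f (s j) (v j))"
      using s R by simp
    fix p :: "(nat \<Rightarrow> 's) \<times> (nat \<Rightarrow> 'v)"
    assume "case p of (s, v) \<Rightarrow> s 0 = s0 \<and> (\<forall>j. R (s j) (v j) \<and> s (Suc j) = f (s j) (v j))"
    then obtain s' v' where p: "p = (s', v')" "s' 0 = s0"
        "\<And>j. R (s' j) (v' j)" "\<And>j. s' (Suc j) = f (s' j) (v' j)"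
      by (cases p) auto
    \<comment> \<open>Equal states at \<open>j\<close> force equal choices at \<open>j\<close>,
      which in turn force equal states at \<open>Suc j\<close>; this drives the induction
      below.\<close>
    have v': "v' j = (THE v. R (s j) v)" if "s' j = s j" for j
      using the1_equality[OF assms(2)[OF I], of j "v' j"] p(3)[of j] that by simp
    have "s' j = s j" for j
      by (induction j) (use p s v' in auto)
    then show "p = (s, \<lambda>j. THE v. R (s j) v)"
      using p(1) v' by auto
  qed
qed

lemma ex1_bij_transfer:
  assumes "\<exists>!x. P x" "\<And>x. Q (h x) \<longleftrightarrow> P x" "bij h"
  shows "\<exists>!y. Q y"
proof -
  obtain x where x: "P x" "\<And>x'. P x' \<Longrightarrow> x' = x"
    using assms(1) by blast
  have "y = h x" if "Q y" for y
    using that x(2)[of "inv h y"] assms(2)[of "inv h y"] surj_f_inv_f[OF bij_is_surj[OF assms(3)]]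
    by metis
  then show ?thesis
    using x(1) assms(2) by blast
qed

text \<open>The product exceeds a square, so both numbers have the same sign, and the positive sum
  excludes the negative one.\<close>

lemma diagonal_pos_of_det_pos:
  fixes a b c :: real
  assumes "a + b > 0" "a * b > c\<^sup>2"
  shows "a > 0" "b > 0"
proof -
  have "a * b > 0"
    using assms(2) zero_le_power2[of c] by linarith
  then have "a > 0 \<and> b > 0 \<or> a < 0 \<and> b < 0"
    by (simp only: zero_less_mult_iff)
  then show "a > 0" "b > 0"
    using assms(1) by linarith+
qed

type_synonym fields = "(real^3 \<Rightarrow> real^3) \<times> (real^3 \<Rightarrow> real^3)"

lemma tangent_space_S1: "\<phi> \<in> tangent_space \<T> m \<Longrightarrow> \<phi> \<in> S1 \<T>"
  by (simp add: tangent_space_def)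

lemma tangent_space_add:
  "\<lbrakk>\<phi> \<in> tangent_space \<T> m; \<psi> \<in> tangent_space \<T> m\<rbrakk> \<Longrightarrow> (\<lambda>x. \<phi> x + \<psi> x) \<in> tangent_space \<T> m"
  by (simp add: tangent_space_def S1_add inner_add_right)

lemma tangent_space_scaleR:
  "\<phi> \<in> tangent_space \<T> m \<Longrightarrow> (\<lambda>x. c *\<^sub>R \<phi> x) \<in> tangent_space \<T> m"
  by (simp add: tangent_space_def S1_scaleR)

section \<open>One time step and the whole run\<close>

context domain_mesh
begin

text \<open>The cross product term is skew and drops out on the diagonal, so the form of the scheme is
  positive definite although it is not symmetric.\<close>

lemma tps_equation_ex1:
  fixes m n :: "real^3 \<Rightarrow> real^3"
  assumes "m \<in> S1 \<T>" "n \<in> S1 \<T>" "\<alpha> > 0" "\<eta> > 0" "a > 0" "\<tau> > 0"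
  shows "\<exists>!v. v \<in> tangent_space \<T> m \<and> tps_equation \<Omega> \<T> \<tau> \<alpha> \<eta> a a12 a0 m n v"
proof -
  define scale :: "real \<Rightarrow> (real^3 \<Rightarrow> real^3) \<Rightarrow> real^3 \<Rightarrow> real^3" where
    "scale = (\<lambda>c f x. c *\<^sub>R f x)"
  \<comment> \<open>\<open>B\<close> and \<open>F\<close> copy the two sides of (T), so the abstract
    problem unfolds to \<open>tps_equation\<close> verbatim.\<close>
  define B where "B v \<phi> = \<alpha> * lumped_inner \<Omega> \<T> v \<phi>
      + lumped_inner \<Omega> \<T> (\<lambda>x. cross3 (m x) (v x)) \<phi> + \<eta> * a * \<tau> * grad_inner \<Omega> v \<phi>" for v \<phi>
  define F where "F \<phi> = - \<eta> * a * grad_inner \<Omega> m \<phi> - \<eta> * a12 * grad_inner \<Omega> n \<phi>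
      + \<eta> * a0 * L2_inner \<Omega> n \<phi>" for \<phi>
  let ?W = "tangent_space \<T> m"
  have plus: "f + g = (\<lambda>x. f x + g x)" for f g :: "real^3 \<Rightarrow> real^3"
    by (simp add: fun_eq_iff)
  have zero: "0 = (\<lambda>x. 0 :: real^3)"
    by (simp add: fun_eq_iff)
  interpret vector_space scale
    unfolding scale_def by unfold_locales (auto simp: fun_eq_iff algebra_simps)
  interpret positive_form scale ?W B
  proof
    show "subspace ?W"
    proof (rule subspaceI)
      show "0 \<in> ?W"
        by (simp add: zero tangent_space_def S1_zero)
    qed (simp_all add: plus scale_def tangent_space_add tangent_space_scaleR)
  next
    fix x y z assume W: "x \<in> ?W" "y \<in> ?W" "z \<in> ?W"
    note S = W[THEN tangent_space_S1]
    show "B z (x + y) = B z x + B z y"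
      using S by (simp add: B_def plus lumped_inner_eq grad_inner_add_right inner_add_right
          distrib_left sum.distrib)
    show "B (x + y) z = B x z + B y z"
      using S by (simp add: B_def plus lumped_inner_eq grad_inner_commute[of _ z] grad_inner_add_right
          inner_add_left cross_add_right distrib_left sum.distrib)
  next
    fix x z c assume W: "x \<in> ?W" "z \<in> ?W"
    note S = W[THEN tangent_space_S1]
    show "B z (scale c x) = c * B z x"
      using S by (simp add: B_def scale_def lumped_inner_eq grad_inner_scaleR_right
          sum_distrib_left distrib_left mult.left_commute)
    show "B (scale c x) z = c * B x z"
      using S by (simp add: B_def scale_def lumped_inner_eq grad_inner_commute[of _ z]
          grad_inner_scaleR_right cross_mult_right sum_distrib_left distrib_left mult.left_commute)
  next
    fix x assume x: "x \<in> ?W" "x \<noteq> 0"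
    have "lumped_inner \<Omega> \<T> (\<lambda>y. cross3 (m y) (x y)) x = 0"
      by (simp add: lumped_inner_eq dot_cross_self)
    moreover have "\<alpha> * lumped_inner \<Omega> \<T> x x > 0"
      using x assms(3) lumped_inner_self_pos[OF tangent_space_S1] by (simp add: zero)
    moreover have "\<eta> * a * \<tau> * grad_inner \<Omega> x x \<ge> 0"
      using grad_inner_nonneg[OF tangent_space_S1[OF x(1)]] assms(4-6) by simp
    ultimately show "B x x > 0"
      by (simp add: B_def)
  qed
  have "functional F"
    unfolding functional_def
  proof (intro conjI ballI allI)
    fix x y assume W: "x \<in> ?W" "y \<in> ?W"
    show "F (x + y) = F x + F y"
      using W[THEN tangent_space_S1] assms(1,2)
      by (simp add: F_def plus grad_inner_add_right L2_inner_add_right algebra_simps)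
  next
    fix x c assume W: "x \<in> ?W"
    show "F (scale c x) = c * F x"
      using W[THEN tangent_space_S1] assms(1,2)
      by (simp add: F_def scale_def grad_inner_scaleR_right L2_inner_scaleR_right algebra_simps)
  qed
  moreover have "?W \<subseteq> span ((\<lambda>(z, b) x. hat z x *\<^sub>R b) ` (vertices \<times> Basis))"
    using S1_subset_span[where 'b = "real^3"] tangent_space_S1 unfolding scale_def by blast
  ultimately have "\<exists>!v. v \<in> ?W \<and> (\<forall>w\<in>?W. B v w = F w)"
    using finite_vertices by (intro ex1_solution) auto
  then show ?thesis
    unfolding tps_equation_def B_def F_def .
qed

text \<open>Unit length is not preserved, since the scheme does not project back to the sphere after
  an update. The inequality is the version that is inherited by the next step, and it still keeps
  the vertex values away from zero.\<close>

definition admissible :: "(real^3 \<Rightarrow> real^3) \<Rightarrow> bool" where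
  "admissible m \<longleftrightarrow> m \<in> S1 \<T> \<and> (\<forall>z\<in>vertices. norm (m z) \<ge> 1)"

lemma admissible_nonvanishing: "admissible m \<Longrightarrow> nonvanishing_at_vertices \<T> m"
  unfolding admissible_def nonvanishing_at_vertices_def by (metis norm_zero not_one_le_zero)

text \<open>A tangential update is orthogonal to \<open>m\<close>, so it does not decrease the length.\<close>

lemma admissible_update:
  assumes "admissible m" "v \<in> tangent_space \<T> m"
  shows "admissible (\<lambda>x. m x + \<tau> *\<^sub>R v x)"
  unfolding admissible_def
proof (intro conjI ballI)
  show "(\<lambda>x. m x + \<tau> *\<^sub>R v x) \<in> S1 \<T>"
    using assms by (intro S1_add S1_scaleR) (auto simp: admissible_def dest: tangent_space_S1)
  fix z assume z: "z \<in> vertices"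
  then have "m z \<bullet> v z = 0"
    using assms(2) by (simp add: tangent_space_def)
  then have "(norm (m z + \<tau> *\<^sub>R v z))\<^sup>2 = (norm (m z))\<^sup>2 + (norm (\<tau> *\<^sub>R v z))\<^sup>2"
    by (intro norm_add_Pythagorean) (simp add: orthogonal_def)
  then have "(norm (m z))\<^sup>2 \<le> (norm (m z + \<tau> *\<^sub>R v z))\<^sup>2"
    using zero_le_power2[of "norm (\<tau> *\<^sub>R v z)"] by linarith
  then have "norm (m z) \<le> norm (m z + \<tau> *\<^sub>R v z)"
    by (rule power2_le_imp_le) (rule norm_ge_zero)
  moreover have "norm (m z) \<ge> 1"
    using assms(1) z by (simp add: admissible_def)
  ultimately show "norm (m z + \<tau> *\<^sub>R v z) \<ge> 1"
    by linarith
qed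

lemma tps_solution_ex1:
  assumes "admissible m1" "admissible m2" "\<alpha>1 > 0" "\<alpha>2 > 0" "\<eta>1 > 0" "\<eta>2 > 0" "a11 > 0" "a22 > 0" "\<tau> > 0"
  shows "\<exists>!(w1, w2). tps_solution \<Omega> \<T> \<tau> \<alpha>1 \<alpha>2 \<eta>1 \<eta>2 a11 a22 a12 a0 m1 m2 w1 w2"
proof -
  have S: "m1 \<in> S1 \<T>" "m2 \<in> S1 \<T>"
    using assms(1,2) by (auto simp: admissible_def)
  let ?P1 = "\<lambda>v. v \<in> tangent_space \<T> m1 \<and> tps_equation \<Omega> \<T> \<tau> \<alpha>1 \<eta>1 a11 a12 a0 m1 m2 v"
  let ?P2 = "\<lambda>v. v \<in> tangent_space \<T> m2 \<and> tps_equation \<Omega> \<T> \<tau> \<alpha>2 \<eta>2 a22 a12 a0 m2 m1 v"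
  have eq: "tps_solution \<Omega> \<T> \<tau> \<alpha>1 \<alpha>2 \<eta>1 \<eta>2 a11 a22 a12 a0 m1 m2 w1 w2 \<longleftrightarrow> ?P1 w1 \<and> ?P2 w2"
    for w1 w2
    unfolding tps_solution_def by blast
  have "\<exists>!v. ?P1 v" "\<exists>!v. ?P2 v"
    using S assms(3-) by (simp_all add: tps_equation_ex1)
  then show ?thesis
    unfolding eq by (rule ex1_pair)
qed

text \<open>The fields at index \<open>i\<close> are determined by the steps before
  \<open>i\<close>, hence the condition \<open>{..<i} \<subseteq> J\<close>; a partial run thus
  includes its last state.\<close>

lemma tps_run_admissible:
  assumes "tps_run \<Omega> \<T> \<tau> \<alpha>1 \<alpha>2 \<eta>1 \<eta>2 a11 a22 a12 a0 m10 m20 J m1 m2 v1 v2"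
    and "admissible m10" "admissible m20" "{..<i} \<subseteq> J"
  shows "admissible (m1 i) \<and> admissible (m2 i)"
  using assms(4)
proof (induction i)
  case 0
  then show ?case
    using assms(1-3) by (simp add: tps_run_def)
next
  case (Suc i)
  then have "admissible (m1 i)" "admissible (m2 i)" "i \<in> J"
    by (auto simp: subset_eq)
  moreover have "v1 i \<in> tangent_space \<T> (m1 i)" "v2 i \<in> tangent_space \<T> (m2 i)"
    "m1 (Suc i) = (\<lambda>x. m1 i x + \<tau> *\<^sub>R v1 i x)" "m2 (Suc i) = (\<lambda>x. m2 i x + \<tau> *\<^sub>R v2 i x)"
    using assms(1) \<open>i \<in> J\<close> by (simp_all add: tps_run_def tps_solution_def)
  ultimately show ?case
    using admissible_update by simp
qed

lemma tps_run_ex1: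
  assumes "admissible m10" "admissible m20"
    and "\<alpha>1 > 0" "\<alpha>2 > 0" "\<eta>1 > 0" "\<eta>2 > 0" "a11 > 0" "a22 > 0" "\<tau> > 0"
  shows "\<exists>!(m1, m2, v1, v2).
    tps_run \<Omega> \<T> \<tau> \<alpha>1 \<alpha>2 \<eta>1 \<eta>2 a11 a22 a12 a0 m10 m20 UNIV m1 m2 v1 v2"
proof -
  define R where "R s v \<longleftrightarrow> tps_solution \<Omega> \<T> \<tau> \<alpha>1 \<alpha>2 \<eta>1 \<eta>2 a11 a22 a12 a0
      (fst s) (snd s) (fst v) (snd v)" for s v :: fields
  define f where "f s v = ((\<lambda>x. fst s x + \<tau> *\<^sub>R fst v x), (\<lambda>x. snd s x + \<tau> *\<^sub>R snd v x))"
    for s v :: fields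
  define run where "run p \<longleftrightarrow> fst p 0 = (m10, m20) \<and>
      (\<forall>j. R (fst p j) (snd p j) \<and> fst p (Suc j) = f (fst p j) (snd p j))"
    for p :: "(nat \<Rightarrow> fields) \<times> (nat \<Rightarrow> fields)"
  define tps where "tps q \<longleftrightarrow> tps_run \<Omega> \<T> \<tau> \<alpha>1 \<alpha>2 \<eta>1 \<eta>2 a11 a22 a12 a0 m10 m20 UNIV
      (fst q) (fst (snd q)) (fst (snd (snd q))) (snd (snd (snd q)))" for q
  \<comment> \<open>The abstract run is a sequence of pairs of fields, the scheme a quadruple of
    sequences; this bijection carries unique existence from one format to the other.\<close>
  define unzip :: "(nat \<Rightarrow> fields) \<times> (nat \<Rightarrow> fields) \<Rightarrow> _"
    where "unzip p = (fst \<circ> fst p, snd \<circ> fst p, fst \<circ> snd p, snd \<circ> snd p)" for p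
  have "\<exists>!(s, v). s 0 = (m10, m20) \<and> (\<forall>j. R (s j) (v j) \<and> s (Suc j) = f (s j) (v j))"
  proof (rule deterministic_run_ex1[where I = "\<lambda>s. admissible (fst s) \<and> admissible (snd s)"])
    show "\<exists>!v. R s v" if "admissible (fst s) \<and> admissible (snd s)" for s
      using tps_solution_ex1[OF _ _ assms(3-), of "fst s" "snd s" a12 a0] that
      by (simp add: R_def case_prod_unfold)
    show "admissible (fst (f s v)) \<and> admissible (snd (f s v))"
      if "admissible (fst s) \<and> admissible (snd s)" "R s v" for s v
      using that admissible_update unfolding R_def f_def tps_solution_def by simp
  qed (use assms(1,2) in simp)
  then have "\<exists>!p. run p"
    by (simp add: run_def case_prod_unfold)
  moreover have "tps (unzip p) \<longleftrightarrow> run p" for p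
    by (auto simp: tps_def unzip_def run_def R_def f_def tps_run_def prod_eq_iff)
  moreover have "bij unzip"
  proof (rule o_bij)
    show "(\<lambda>q. (\<lambda>j. (fst q j, fst (snd q) j), \<lambda>j. (fst (snd (snd q)) j, snd (snd (snd q)) j))) \<circ> unzip = id"
      "unzip \<circ> (\<lambda>q. (\<lambda>j. (fst q j, fst (snd q) j), \<lambda>j. (fst (snd (snd q)) j, snd (snd (snd q)) j))) = id"
      by (simp_all add: fun_eq_iff unzip_def)
  qed
  ultimately have "\<exists>!q. tps q"
    by (rule ex1_bij_transfer)
  then show ?thesis
    by (simp add: tps_def case_prod_unfold)
qed

end

lemma domain_mesh_shape_regular_family:
  assumes "lipschitz_polyhedral_domain \<Omega>" "shape_regular_family \<Omega> F" "\<T> \<in> F"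
  shows "domain_mesh \<T> \<Omega>"
proof
  have "tetrahedral_mesh \<Omega> \<T>"
    using assms(2,3) by (simp add: shape_regular_family_def)
  then show "triangulation \<T>" "\<Union>\<T> = closure \<Omega>" "\<And>T. T \<in> \<T> \<Longrightarrow> 3 simplex T"
    by (simp_all add: tetrahedral_mesh_def)
  show "open \<Omega>"
    using assms(1) by (simp add: lipschitz_polyhedral_domain_def)
qed

theorem proposition5p2:
  fixes \<Omega> :: "(real^3) set" and F :: "(real^3) set set set" and \<T> :: "(real^3) set set"
    and h \<tau> \<alpha>1 \<alpha>2 \<eta>1 \<eta>2 a11 a22 a12 a0 :: real
    and m10 m20 :: "real^3 \<Rightarrow> real^3"
  assumes "lipschitz_polyhedral_domain \<Omega>"
    and "a11 + a22 > 0" and "a11 * a22 > a12\<^sup>2"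
    and "\<eta>1 > 0" and "\<eta>2 > 0" and "\<alpha>1 > 0" and "\<alpha>2 > 0"
    and "shape_regular_family \<Omega> F" and "\<T> \<in> F"
    and "h = mesh_size \<T>" and "h > 0" and "\<tau> > 0"
    and "m10 \<in> S1 \<T>" and "\<forall>z\<in>mesh_vertices \<T>. norm (m10 z) = 1"
    and "m20 \<in> S1 \<T>" and "\<forall>z\<in>mesh_vertices \<T>. norm (m20 z) = 1"
  shows "(\<forall>i m1 m2 v1 v2.
           tps_run \<Omega> \<T> \<tau> \<alpha>1 \<alpha>2 \<eta>1 \<eta>2 a11 a22 a12 a0 m10 m20 {..<i} m1 m2 v1 v2 \<longrightarrow>
             m1 i \<in> S1 \<T> \<and> nonvanishing_at_vertices \<T> (m1 i) \<and>
             m2 i \<in> S1 \<T> \<and> nonvanishing_at_vertices \<T> (m2 i) \<and>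
             (\<exists>!(w1, w2).
                tps_solution \<Omega> \<T> \<tau> \<alpha>1 \<alpha>2 \<eta>1 \<eta>2 a11 a22 a12 a0 (m1 i) (m2 i) w1 w2)) \<and>
         (\<exists>!(m1, m2, v1, v2).
           tps_run \<Omega> \<T> \<tau> \<alpha>1 \<alpha>2 \<eta>1 \<eta>2 a11 a22 a12 a0 m10 m20 UNIV m1 m2 v1 v2)"
proof -
  interpret domain_mesh \<T> \<Omega>
    using assms(1,8,9) by (rule domain_mesh_shape_regular_family)
  have a: "a11 > 0" "a22 > 0"
    using diagonal_pos_of_det_pos[OF assms(2,3)] by simp_all
  have m0: "admissible m10" "admissible m20"
    using assms(13-16) by (simp_all add: admissible_def)
  show ?thesis
  proof (intro conjI allI impI)
    fix i m1 m2 v1 v2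
    assume run: "tps_run \<Omega> \<T> \<tau> \<alpha>1 \<alpha>2 \<eta>1 \<eta>2 a11 a22 a12 a0 m10 m20 {..<i} m1 m2 v1 v2"
    have adm: "admissible (m1 i)" "admissible (m2 i)"
      using tps_run_admissible[OF run m0 subset_refl] by simp_all
    show "m1 i \<in> S1 \<T>" "m2 i \<in> S1 \<T>"
      using adm by (simp_all add: admissible_def)
    show "nonvanishing_at_vertices \<T> (m1 i)" "nonvanishing_at_vertices \<T> (m2 i)"
      using adm by (simp_all add: admissible_nonvanishing)
    show "\<exists>!(w1, w2). tps_solution \<Omega> \<T> \<tau> \<alpha>1 \<alpha>2 \<eta>1 \<eta>2 a11 a22 a12 a0 (m1 i) (m2 i) w1 w2"
      by (rule tps_solution_ex1[OF adm assms(6,7,4,5) a assms(12)])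
  next
    show "\<exists>!(m1, m2, v1, v2).
        tps_run \<Omega> \<T> \<tau> \<alpha>1 \<alpha>2 \<eta>1 \<eta>2 a11 a22 a12 a0 m10 m20 UNIV m1 m2 v1 v2"
      by (rule tps_run_ex1[OF m0 assms(6,7,4,5) a assms(12)])
  qed
qed

end
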